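(* There exist positive integers $n_1, n_2$ with $n_1 + n_2 \geq 3$ and a set $S$ of the form $$S = \left\{ (x,y) \in [0,1]^{n_1}\times[0,1]^{n_2} \;\middle|\; x^\top Q_k y + a_k^\top x + b_k^\top y + c_k = 0,\; k \in \{1,2\} \right\},$$ with $Q_k \in \mathbb{R}^{n_1\times n_2}$, $a_k\in\mathbb{R}^{n_1}$, $b_k \in \mathbb{R}^{n_2}$, $c_k \in \mathbb{R}$ for $k\in\{1,2\}$, such that $S$ is nonempty, the two constraints are independent, and infinitely many aggregations are needed to obtain the convex hull, that is, $$\operatorname{conv}(S) = \bigcap_{\lambda \in \mathbb{R}^2} \operatorname{conv}(S_\lambda),$$ while for every $T \subseteq \mathbb{R}^2$ with $|T| < \infty$, $$\operatorname{conv}(S) \subsetneq \bigcap_{\lambda \in T} \operatorname{conv}(S_\lambda).$$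
   Context: $\operatorname{conv}(\cdot)$ denotes the convex hull. For $\lambda = (\lambda_1,\lambda_2)\in\mathbb{R}^2$, the aggregation $S_\lambda$ of $S$ is $$S_\lambda = \left\{ (x,y)\in[0,1]^{n_1}\times[0,1]^{n_2} \;\middle|\; \sum_{k=1}^{2}\lambda_k\left(x^\top Q_k y + a_k^\top x + b_k^\top y + c_k\right) = 0 \right\}.$$ The two constraints are called independent if there is no $\mu\in\mathbb{R}$ such that $x^\top Q_1 y + a_1^\top x + b_1^\top y + c_1 = \mu\,(x^\top Q_2 y + a_2^\top x + b_2^\top y + c_2)$ identically in $(x,y)$. An intersection over an empty index set is understood to be the whole ambient space $\mathbb{R}^{n_1}\times\mathbb{R}^{n_2}$. *)

theory Defs
  imports "HOL-Analysis.Analysis" "HOL-Analysis.Finite_Function_Topology"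
begin

text \<open>
  The dimensions are existentially quantified natural numbers, so they cannot be types. The space
  of real \<open>n\<close>-vectors is the subspace of the real vector space of finitely supported sequences
  consisting of those supported on the indices \<open>0, \<dots>, n - 1\<close>. The library's convex hull
  is taken in the type of pairs of such sequences; as the product of two of these subspaces is
  convex, it agrees with the hull taken inside the product.
\<close>

type_synonym rvec = "nat \<Rightarrow>\<^sub>0 real"

definition rspace :: "nat \<Rightarrow> rvec set" where
  "rspace n = {x. Poly_Mapping.keys x \<subseteq> {..<n}}"

definition unit_cube :: "nat \<Rightarrow> rvec set" where
  "unit_cube n = {x \<in> rspace n. \<forall>i<n. 0 \<le> Poly_Mapping.lookup x i \<and> Poly_Mapping.lookup x i \<le> 1}"

text \<open>Only the entries \<open>Q i j\<close> with \<open>i < n1\<close> and \<open>j < n2\<close> matter.\<close>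

definition bilin_fun ::
  "nat \<Rightarrow> nat \<Rightarrow> (nat \<Rightarrow> nat \<Rightarrow> real) \<Rightarrow> rvec \<Rightarrow> rvec \<Rightarrow> real \<Rightarrow> rvec \<Rightarrow> rvec \<Rightarrow> real" where
  "bilin_fun n1 n2 Q a b c x y =
     (\<Sum>i<n1. \<Sum>j<n2. Poly_Mapping.lookup x i * Q i j * Poly_Mapping.lookup y j)
     + (\<Sum>i<n1. Poly_Mapping.lookup a i * Poly_Mapping.lookup x i)
     + (\<Sum>j<n2. Poly_Mapping.lookup b j * Poly_Mapping.lookup y j) + c"

text \<open>
  The two constraints are indexed by the two-element type \<open>2\<close>, whose elements are \<open>1\<close> and \<open>2\<close>.
\<close>

definition bilin_set ::
  "nat \<Rightarrow> nat \<Rightarrow> (2 \<Rightarrow> nat \<Rightarrow> nat \<Rightarrow> real) \<Rightarrow> (2 \<Rightarrow> rvec) \<Rightarrow> (2 \<Rightarrow> rvec) \<Rightarrow> (2 \<Rightarrow> real)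
    \<Rightarrow> (rvec \<times> rvec) set" where
  "bilin_set n1 n2 Q a b c =
     {(x, y) \<in> unit_cube n1 \<times> unit_cube n2.
        \<forall>k. bilin_fun n1 n2 (Q k) (a k) (b k) (c k) x y = 0}"

definition aggregation ::
  "nat \<Rightarrow> nat \<Rightarrow> (2 \<Rightarrow> nat \<Rightarrow> nat \<Rightarrow> real) \<Rightarrow> (2 \<Rightarrow> rvec) \<Rightarrow> (2 \<Rightarrow> rvec) \<Rightarrow> (2 \<Rightarrow> real)
    \<Rightarrow> real ^ 2 \<Rightarrow> (rvec \<times> rvec) set" where
  "aggregation n1 n2 Q a b c lam =
     {(x, y) \<in> unit_cube n1 \<times> unit_cube n2.
        (\<Sum>k\<in>UNIV. lam $ k * bilin_fun n1 n2 (Q k) (a k) (b k) (c k) x y) = 0}"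

definition independent_constraints ::
  "nat \<Rightarrow> nat \<Rightarrow> (2 \<Rightarrow> nat \<Rightarrow> nat \<Rightarrow> real) \<Rightarrow> (2 \<Rightarrow> rvec) \<Rightarrow> (2 \<Rightarrow> rvec) \<Rightarrow> (2 \<Rightarrow> real)
    \<Rightarrow> bool" where
  "independent_constraints n1 n2 Q a b c \<longleftrightarrow>
     \<not> (\<exists>\<mu>. \<forall>x\<in>rspace n1. \<forall>y\<in>rspace n2.
          bilin_fun n1 n2 (Q 1) (a 1) (b 1) (c 1) x y
          = \<mu> * bilin_fun n1 n2 (Q 2) (a 2) (b 2) (c 2) x y)"

text \<open>
  Intersecting with the ambient space changes only the case of the empty index set.
\<close>

definition hull_Inter ::
  "nat \<Rightarrow> nat \<Rightarrow> (2 \<Rightarrow> nat \<Rightarrow> nat \<Rightarrow> real) \<Rightarrow> (2 \<Rightarrow> rvec) \<Rightarrow> (2 \<Rightarrow> rvec) \<Rightarrow> (2 \<Rightarrow> real)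
    \<Rightarrow> (real ^ 2) set \<Rightarrow> (rvec \<times> rvec) set" where
  "hull_Inter n1 n2 Q a b c T =
     (rspace n1 \<times> rspace n2) \<inter> (\<Inter>lam\<in>T. convex hull (aggregation n1 n2 Q a b c lam))"

end

theory Submission
  imports Defs
begin

text \<open>
  The example is \<open>z = x y\<close>, \<open>x = y\<close> with \<open>n1 = 1\<close> and \<open>n2 = 2\<close>, the second block being \<open>(y, z)\<close>.
  Here \<open>S\<close> is the parabola arc \<open>(t, t, t\<^sup>2)\<close>, whose hull is \<open>x = y\<close>, \<open>x\<^sup>2 \<le> z \<le> x\<close>. The two original
  constraints give \<open>x = y\<close> and \<open>z \<le> x\<close>. The aggregation \<open>z - x y + m (x - y) = 0\<close> satisfies
  \<open>\<bar>x - y\<bar> \<le> 1 / m\<close>, so on it the linear function \<open>z + m (x - y) = x y\<close> is at least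
  \<open>t (x + y) - t\<^sup>2 - 1 / (4 m\<^sup>2)\<close> for every \<open>t\<close>; on the hull, \<open>x = y = t\<close> yields \<open>z \<ge> x\<^sup>2 - 1 / (4 m\<^sup>2)\<close>,
  and \<open>m \<rightarrow> \<infinity>\<close> finishes. On the other hand every such aggregation contains, for small \<open>e\<close>, the points
  \<open>(1/2 \<plusminus> e, 1/2 \<mp> e, 1/4 - e\<^sup>2 \<mp> 2 m e)\<close>, whose midpoint lies strictly below the parabola;
  finitely many aggregations share a common \<open>e\<close>.
\<close>

section \<open>Real triples as coordinates on the ambient space\<close>

definition triple_vec :: "real \<times> real \<times> real \<Rightarrow> rvec \<times> rvec" where
  "triple_vec = (\<lambda>(x, y, z). (Poly_Mapping.single 0 x, Poly_Mapping.single 0 y + Poly_Mapping.single 1 z))"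

lemma lookup_scaleR: "Poly_Mapping.lookup (r *\<^sub>R x) i = r *\<^sub>R Poly_Mapping.lookup x i"
proof -
  have "finite {i. r *\<^sub>R Poly_Mapping.lookup x i \<noteq> 0}"
    by (rule finite_subset[OF _ finite_keys[of x]]) (auto simp: in_keys_iff)
  then show ?thesis
    by (simp add: scaleR_poly_mapping_def Abs_poly_mapping_inverse)
qed

text \<open>Linearity makes \<open>triple_vec\<close> commute with convex hulls. Together with
  injectivity and the range below, it moves the geometry to real triples.\<close>

lemma linear_triple_vec: "linear triple_vec"
  by (rule linearI)
    (auto simp: triple_vec_def poly_mapping_eq_iff fun_eq_iff lookup_add lookup_single
        lookup_scaleR when_def)

lemma inj_triple_vec: "inj triple_vec"
proof (rule injI)
  fix p q assume "triple_vec p = triple_vec q"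
  then have "Poly_Mapping.lookup (fst (triple_vec p)) 0 = Poly_Mapping.lookup (fst (triple_vec q)) 0"
    "\<And>i. Poly_Mapping.lookup (snd (triple_vec p)) i = Poly_Mapping.lookup (snd (triple_vec q)) i"
    by auto
  from this(1) this(2)[of 0] this(2)[of 1] show "p = q"
    by (auto simp: triple_vec_def lookup_add lookup_single when_def split: prod.splits)
qed

lemma range_triple_vec: "range triple_vec = rspace 1 \<times> rspace 2"
proof (intro equalityI subsetI)
  fix p assume "p \<in> range triple_vec"
  then show "p \<in> rspace 1 \<times> rspace 2"
    by (auto simp: triple_vec_def rspace_def lookup_add lookup_single when_def in_keys_iff
        split: if_splits)
next
  fix p assume "p \<in> rspace 1 \<times> rspace 2"
  then obtain v w where p: "p = (v, w)" "v \<in> rspace 1" "w \<in> rspace 2" by auto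
  have v: "Poly_Mapping.lookup v i = 0" if "i \<noteq> 0" for i
    using p(2) that by (auto simp: rspace_def in_keys_iff)
  have w: "Poly_Mapping.lookup w i = 0" if "i \<noteq> 0" "i \<noteq> 1" for i
  proof -
    have "\<not> i < 2" using that by linarith
    then show ?thesis using p(3) by (auto simp: rspace_def in_keys_iff)
  qed
  have "p = triple_vec (Poly_Mapping.lookup v 0, Poly_Mapping.lookup w 0, Poly_Mapping.lookup w 1)"
    using v w by (auto simp: p(1) triple_vec_def poly_mapping_eq_iff fun_eq_iff lookup_add lookup_single when_def)
  then show "p \<in> range triple_vec" by blast
qed

abbreviation "cube3 \<equiv> {0..1::real} \<times> {0..1::real} \<times> {0..1::real}"

lemma triple_vec_in_unit_cube: "triple_vec p \<in> unit_cube 1 \<times> unit_cube 2 \<longleftrightarrow> p \<in> cube3"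
proof -
  have "triple_vec p \<in> rspace 1 \<times> rspace 2"
    using range_triple_vec by blast
  moreover have "(\<forall>i<2. P i) \<longleftrightarrow> P 0 \<and> P (1::nat)" for P
    by (auto simp: less_2_cases_iff)
  ultimately show ?thesis
    by (auto simp: unit_cube_def triple_vec_def lookup_add lookup_single when_def
        split: prod.splits)
qed

section \<open>The constraints \<open>z - x * y = 0\<close> and \<open>x - y = 0\<close> in
  coordinates\<close>

definition ex_Q :: "2 \<Rightarrow> nat \<Rightarrow> nat \<Rightarrow> real" where
  "ex_Q k i j = (if k = 1 \<and> i = 0 \<and> j = 0 then - 1 else 0)"

definition ex_a :: "2 \<Rightarrow> rvec" where
  "ex_a k = (if k = 1 then 0 else Poly_Mapping.single 0 1)"

definition ex_b :: "2 \<Rightarrow> rvec" where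
  "ex_b k = (if k = 1 then Poly_Mapping.single 1 1 else Poly_Mapping.single 0 (- 1))"

definition agg_set :: "real \<Rightarrow> real \<Rightarrow> (real \<times> real \<times> real) set" where
  "agg_set u v = {(x, y, z) \<in> cube3. u * (z - x * y) + v * (x - y) = 0}"

definition par_arc :: "(real \<times> real \<times> real) set" where
  "par_arc = {(x, y, z) \<in> cube3. z = x * y \<and> x = y}"

lemma bilin_fun_ex:
  fixes x y z :: real
  defines "p \<equiv> triple_vec (x, y, z)"
  shows "bilin_fun 1 2 (ex_Q 1) (ex_a 1) (ex_b 1) 0 (fst p) (snd p) = z - x * y"
    and "bilin_fun 1 2 (ex_Q 2) (ex_a 2) (ex_b 2) 0 (fst p) (snd p) = x - y"
  by (simp_all add: p_def triple_vec_def bilin_fun_def ex_Q_def ex_a_def ex_b_def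
      numeral_2_eq_2 lookup_add lookup_single when_def)

text \<open>The range of \<open>triple_vec\<close> contains the product of the unit cubes, so it is
  enough to test membership at preimages in \<open>cube3\<close>.\<close>

lemma set_eq_triple_vec_image:
  assumes "A \<subseteq> unit_cube 1 \<times> unit_cube 2"
    and "\<And>p. p \<in> cube3 \<Longrightarrow> triple_vec p \<in> A \<longleftrightarrow> p \<in> B" and "B \<subseteq> cube3"
  shows "A = triple_vec ` B"
proof (intro equalityI subsetI)
  fix q assume q: "q \<in> A"
  then have "q \<in> rspace 1 \<times> rspace 2"
    using assms(1) by (auto simp: unit_cube_def)
  then obtain p where p: "q = triple_vec p"
    using range_triple_vec by blast
  then have "p \<in> cube3"
    using q assms(1) triple_vec_in_unit_cube by blast
  then show "q \<in> triple_vec ` B"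
    using assms(2) p q by blast
qed (use assms in blast)

lemma bilin_set_ex: "bilin_set 1 2 ex_Q ex_a ex_b (\<lambda>_. 0) = triple_vec ` par_arc"
proof (rule set_eq_triple_vec_image)
  fix p assume "p \<in> cube3"
  then show "triple_vec p \<in> bilin_set 1 2 ex_Q ex_a ex_b (\<lambda>_. 0) \<longleftrightarrow> p \<in> par_arc"
    using triple_vec_in_unit_cube[of p] bilin_fun_ex
    by (cases p) (auto simp: bilin_set_def par_arc_def forall_2 case_prod_unfold)
qed (auto simp: bilin_set_def par_arc_def)

lemma aggregation_ex:
  "aggregation 1 2 ex_Q ex_a ex_b (\<lambda>_. 0) lam = triple_vec ` agg_set (lam $ 1) (lam $ 2)"
proof (rule set_eq_triple_vec_image)
  fix p assume "p \<in> cube3"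
  then show "triple_vec p \<in> aggregation 1 2 ex_Q ex_a ex_b (\<lambda>_. 0) lam \<longleftrightarrow> p \<in> agg_set (lam $ 1) (lam $ 2)"
    using triple_vec_in_unit_cube[of p] bilin_fun_ex
    by (cases p) (auto simp: aggregation_def agg_set_def sum_2 case_prod_unfold)
qed (auto simp: aggregation_def agg_set_def)

text \<open>Injectivity lets the image pass through intersections. For empty \<open>T\<close> both
  sides are the range of \<open>triple_vec\<close>, which is the ambient space.\<close>

lemma hull_Inter_ex:
  "hull_Inter 1 2 ex_Q ex_a ex_b (\<lambda>_. 0) T
    = triple_vec ` (\<Inter>lam\<in>T. convex hull (agg_set (lam $ 1) (lam $ 2)))"
  unfolding hull_Inter_def aggregation_ex range_triple_vec[symmetric]
  using inj_triple_vec by (auto simp: convex_hull_linear_image[OF linear_triple_vec, symmetric] inj_image_mem_iff)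

section \<open>Half-space bounds and the intersection of all aggregation hulls\<close>

lemma convex_hull_halfspace:
  fixes a b c d :: real
  assumes "\<And>x y z. (x, y, z) \<in> S \<Longrightarrow> d \<le> a * x + b * y + c * z"
    and "(x, y, z) \<in> convex hull S"
  shows "d \<le> a * x + b * y + c * z"
proof -
  have "S \<subseteq> {p. inner (a, b, c) p \<ge> d}"
    using assms(1) by (auto simp: algebra_simps)
  then have "convex hull S \<subseteq> {p. inner (a, b, c) p \<ge> d}"
    by (intro hull_minimal convex_halfspace_ge)
  then show ?thesis
    using assms(2) by (auto simp: algebra_simps)
qed

lemma agg_hull_lower:
  assumes m: "m > 0" and "(t, t, z) \<in> convex hull (agg_set 1 m)"
  shows "z \<ge> t\<^sup>2 - 1 / (4 * m\<^sup>2)"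
proof -
  \<comment> \<open>The functional is \<open>z + m * (x - y) - t * (x + y)\<close>. At
    \<open>(t, t, z)\<close> the terms in \<open>m\<close> cancel and
    \<open>z - 2 * t\<^sup>2\<close> remains, so this bound turns into the claim.\<close>
  have *: "- t\<^sup>2 - 1 / (4 * m\<^sup>2) \<le> (m - t) * x + (- m - t) * y + 1 * z"
    if "(x, y, z) \<in> agg_set 1 m" for x y z
  proof -
    have "0 \<le> x" "x \<le> 1" "0 \<le> y" "y \<le> 1" "0 \<le> z" "z \<le> 1" and eq: "m * (x - y) = x * y - z"
      using that by (auto simp: agg_set_def algebra_simps)
    moreover from this have "0 \<le> x * y" "x * y \<le> 1"
      by (auto simp: mult_le_one)
    ultimately have "\<bar>m * (x - y)\<bar> \<le> 1" by linarith
    then have "(m * (x - y))\<^sup>2 \<le> 1" by (simp add: abs_square_le_1)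
    then have "(x - y)\<^sup>2 * m\<^sup>2 \<le> 1" by (simp only: power_mult_distrib mult.commute)
    then have "(x - y)\<^sup>2 / 4 \<le> 1 / (4 * m\<^sup>2)"
      using m by (simp add: pos_le_divide_eq)
    \<comment> \<open>A difference of squares of \<open>(x + y) / 2\<close> and
      \<open>(x - y) / 2\<close>, with the first square expanded about \<open>t\<close>: it exceeds
      its tangent there by a square.\<close>
    moreover have "x * y = t * (x + y) - t\<^sup>2 + ((x + y) / 2 - t)\<^sup>2 - (x - y)\<^sup>2 / 4"
      by (simp add: power2_eq_square field_simps)
    moreover have "((x + y) / 2 - t)\<^sup>2 \<ge> 0" by simp
    moreover have "(m - t) * x + (- m - t) * y + 1 * z = m * (x - y) + z - t * (x + y)"
      by (simp add: algebra_simps)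
    ultimately show ?thesis
      using eq by linarith
  qed
  from convex_hull_halfspace[OF * assms(2)] show ?thesis
    by (simp add: algebra_simps power2_eq_square)
qed

text \<open>The point lies on the vertical segment from \<open>(t, t, t\<^sup>2)\<close> on the arc
  up to \<open>(t, t, t)\<close> on the chord joining the ends of the arc. The hypotheses give
  \<open>t\<^sup>2 \<le> t\<close>, hence \<open>t\<close> is between 0 and 1.\<close>

lemma par_arc_hull_superset:
  assumes "t\<^sup>2 \<le> z" "z \<le> t"
  shows "(t, t, z) \<in> convex hull par_arc"
proof -
  have t: "0 \<le> t" "t \<le> 1"
  proof -
    show "0 \<le> t" using assms zero_le_power2[of t] by linarith
    show "t \<le> 1"
    proof (rule ccontr)
      assume "\<not> t \<le> 1"
      then have "t * 1 < t * t" by (intro mult_strict_left_mono) auto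
      then show False using assms by (simp add: power2_eq_square)
    qed
  qed
  have arc: "(s, s, s\<^sup>2) \<in> convex hull par_arc" if "0 \<le> s" "s \<le> 1" for s
    using that by (intro hull_inc) (auto simp: par_arc_def power2_eq_square mult_le_one)
  have "(1 - t) *\<^sub>R (0, 0, 0) + t *\<^sub>R (1, 1, 1) \<in> convex hull par_arc"
    using arc[of 0] arc[of 1] t by (intro convexD[OF convex_convex_hull]) auto
  then have chord: "(t, t, t) \<in> convex hull par_arc" by simp
  have "z \<in> closed_segment (t\<^sup>2) t"
    using assms by (simp add: closed_segment_eq_real_ivl)
  then obtain u where u: "0 \<le> u" "u \<le> 1" "z = (1 - u) * t\<^sup>2 + u * t"
    by (auto simp: closed_segment_def)
  have "(1 - u) *\<^sub>R (t, t, t\<^sup>2) + u *\<^sub>R (t, t, t) \<in> convex hull par_arc"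
    using arc[OF t] chord u by (intro convexD[OF convex_convex_hull]) auto
  moreover have "(1 - u) * t + u * t = t" by (simp add: algebra_simps)
  ultimately show ?thesis using u(3) by simp
qed

lemma par_arc_subset_agg: "par_arc \<subseteq> agg_set u v"
  by (auto simp: par_arc_def agg_set_def)

lemma Inter_hull_agg:
  "(\<Inter>lam\<in>UNIV. convex hull (agg_set ((lam::real^2) $ 1) (lam $ 2))) = convex hull par_arc"
proof (intro equalityI subsetI)
  fix p assume "p \<in> (\<Inter>lam\<in>UNIV. convex hull (agg_set ((lam::real^2) $ 1) (lam $ 2)))"
  then have "p \<in> convex hull (agg_set ((vector [u, v] :: real^2) $ 1) ((vector [u, v] :: real^2) $ 2))" for u v
    by blast
  then have p: "p \<in> convex hull (agg_set u v)" for u v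
    by simp
  obtain x y z where xyz: "p = (x, y, z)" by (cases p) auto
  \<comment> \<open>Weights \<open>(0, 1)\<close> give the plane \<open>x = y\<close>, used as two
    half-spaces.\<close>
  have "0 \<le> 1 * x + (-1) * y + 0 * z"
    by (rule convex_hull_halfspace[OF _ p[of 0 1, unfolded xyz]]) (simp add: agg_set_def)
  moreover have "0 \<le> (-1) * x + 1 * y + 0 * z"
    by (rule convex_hull_halfspace[OF _ p[of 0 1, unfolded xyz]]) (simp add: agg_set_def)
  ultimately have y: "y = x" by simp
  \<comment> \<open>Weights \<open>(1, 0)\<close> give \<open>z = x * y\<close>, which is at most
    \<open>x\<close> on the cube.\<close>
  have "0 \<le> 1 * x + 0 * y + (-1) * z"
    by (rule convex_hull_halfspace[OF _ p[of 1 0, unfolded xyz]]) (auto simp: agg_set_def mult_left_le)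
  then have zx: "z \<le> x" by simp
  \<comment> \<open>The multipliers \<open>m = Suc n\<close> are positive and unbounded, so the
    error term vanishes in the limit.\<close>
  have "x\<^sup>2 - 1 / (4 * (real (Suc n))\<^sup>2) \<le> z" for n
    using agg_hull_lower[of "real (Suc n)" x z] p xyz y by simp
  moreover have "(\<lambda>n. x\<^sup>2 - 1 / (4 * (real (Suc n))\<^sup>2)) \<longlonglongrightarrow> x\<^sup>2 - 1/4 * 0\<^sup>2"
  proof -
    have "(\<lambda>n. x\<^sup>2 - 1/4 * (1 / real (Suc n))\<^sup>2) \<longlonglongrightarrow> x\<^sup>2 - 1/4 * 0\<^sup>2"
      by (intro tendsto_intros LIMSEQ_Suc[OF lim_1_over_n])
    then show ?thesis by (simp add: power_divide)
  qed
  ultimately have "x\<^sup>2 \<le> z"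
    by (intro LIMSEQ_le_const2[of _ "x\<^sup>2" z]) auto
  then show "p \<in> convex hull par_arc"
    using par_arc_hull_superset zx xyz y by blast
next
  fix p assume "p \<in> convex hull par_arc"
  then show "p \<in> (\<Inter>lam\<in>UNIV. convex hull (agg_set ((lam::real^2) $ 1) (lam $ 2)))"
    using hull_mono[OF par_arc_subset_agg] by blast
qed

section \<open>A point below the arc shared by finitely many aggregation hulls\<close>

lemma below_arc_in_agg_hull:
  assumes e: "0 \<le> e" "e \<le> 1/4" and bound: "e * \<bar>v / u\<bar> \<le> 1/16"
  shows "(1/2, 1/2, 1/4 - e\<^sup>2) \<in> convex hull (agg_set u v)"
proof -
  have "e\<^sup>2 \<le> (1/4)\<^sup>2" using e by (intro power_mono) auto
  then have e2: "0 \<le> e\<^sup>2" "e\<^sup>2 \<le> 1/16" by (simp_all add: power2_eq_square)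
  show ?thesis
  proof (cases "u = 0")
    case True
    \<comment> \<open>The equation reduces to \<open>v * (x - y) = 0\<close>, which the point itself
      satisfies.\<close>
    have "0 \<le> 1/4 - e\<^sup>2" "1/4 - e\<^sup>2 \<le> 1" using e2 by linarith+
    then have "(1/2, 1/2, 1/4 - e\<^sup>2) \<in> agg_set u v"
      using True by (simp add: agg_set_def)
    then show ?thesis by (rule hull_inc)
  next
    case False
    define m where "m = v / u"
    have em: "\<bar>e * m\<bar> \<le> 1/16" using bound e by (simp add: m_def abs_mult)
    \<comment> \<open>The third coordinate comes from solving the aggregation equation for
      \<open>z\<close> at \<open>x = 1/2 + s\<close>, \<open>y = 1/2 - s\<close>.\<close>
    have pt: "(1/2 + s, 1/2 - s, 1/4 - s\<^sup>2 - 2 * s * m) \<in> convex hull (agg_set u v)"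
      if s: "s = e \<or> s = - e" for s
    proof (rule hull_inc)
      have "u * (1/4 - s\<^sup>2 - 2 * s * m - (1/2 + s) * (1/2 - s)) + v * (1/2 + s - (1/2 - s)) = 0"
        using False by (simp add: m_def field_simps power2_eq_square)
      \<comment> \<open>Since \<open>s\<^sup>2 \<le> 1/16\<close> and
        \<open>\<bar>2 * s * m\<bar> \<le> 1/8\<close>, the value stays between 1/16 and
        3/8.\<close>
      moreover have "0 \<le> 1/4 - s\<^sup>2 - 2 * s * m" "1/4 - s\<^sup>2 - 2 * s * m \<le> 1"
        using e2 em s abs_le_D1[OF em] abs_le_D2[OF em] by (elim disjE; simp; linarith)+
      ultimately show "(1/2 + s, 1/2 - s, 1/4 - s\<^sup>2 - 2 * s * m) \<in> agg_set u v"
        using e s by (auto simp: agg_set_def)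
    qed
    \<comment> \<open>The terms \<open>2 * e * m\<close> are odd in \<open>e\<close> and cancel in
      the midpoint, while \<open>e\<^sup>2\<close> survives.\<close>
    have "(1/2) *\<^sub>R (1/2 + e, 1/2 - e, 1/4 - e\<^sup>2 - 2 * e * m)
        + (1/2) *\<^sub>R (1/2 + - e, 1/2 - - e, 1/4 - (- e)\<^sup>2 - 2 * (- e) * m) \<in> convex hull (agg_set u v)"
      using pt[of e] pt[of "- e"] by (intro convexD[OF convex_convex_hull]) auto
    then show ?thesis by (simp add: algebra_simps)
  qed
qed

text \<open>The half-space \<open>z \<ge> x - 1/4\<close> contains the arc and is tangent to it at
  \<open>x = 1/2\<close>, because \<open>x\<^sup>2 - x + 1/4\<close> is a square. The point violates
  it by \<open>e\<^sup>2\<close>.\<close>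

lemma below_arc_notin_hull:
  assumes "e \<noteq> 0"
  shows "(1/2, 1/2, 1/4 - e\<^sup>2) \<notin> convex hull par_arc"
proof
  assume hull: "(1/2, 1/2, 1/4 - e\<^sup>2) \<in> convex hull par_arc"
  have "-1/4 \<le> (-1) * x + 0 * y + 1 * z" if "(x, y, z) \<in> par_arc" for x y z
  proof -
    have "0 \<le> (x - 1/2)\<^sup>2" by simp
    then show ?thesis using that by (auto simp: par_arc_def power2_eq_square algebra_simps)
  qed
  from convex_hull_halfspace[OF this hull]
  have "-1/4 \<le> (-1) * (1/2) + 0 * (1/2) + 1 * (1/4 - e\<^sup>2)" .
  then show False using assms by simp
qed

lemma finite_Inter_hull_agg:
  fixes T :: "(real^2) set"
  assumes "finite T"
  shows "convex hull par_arc \<subset> (\<Inter>lam\<in>T. convex hull (agg_set (lam $ 1) (lam $ 2)))"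
proof -
  have strict: "A \<subset> B" if "p \<in> B" "p \<notin> A" "A \<subseteq> B" for p and A B :: "(real \<times> real \<times> real) set"
    using that by blast
  \<comment> \<open>The sum bounds each of the finitely many ratios and is 0 for empty
    \<open>T\<close>. A ratio with zero denominator counts as 0.\<close>
  define M where "M = (\<Sum>lam\<in>T. \<bar>lam $ 2 / lam $ 1\<bar>)"
  have M: "\<bar>lam $ 2 / lam $ 1\<bar> \<le> M" if "lam \<in> T" for lam
    unfolding M_def using assms that by (intro member_le_sum) auto
  have "0 \<le> M" unfolding M_def by (intro sum_nonneg) auto
  \<comment> \<open>Adding 1 keeps the denominator positive and bounds \<open>e\<close> itself,
    while \<open>M / (M + 1) \<le> 1\<close> bounds \<open>e * M\<close>.\<close>
  define e where "e = 1 / (16 * (M + 1))"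
  have e: "0 < e" "e \<le> 1/4" "e * M \<le> 1/16"
    using \<open>0 \<le> M\<close> by (auto simp: e_def field_simps)
  have "e * \<bar>lam $ 2 / lam $ 1\<bar> \<le> 1/16" if "lam \<in> T" for lam
    using mult_left_mono[OF M[OF that], of e] e by linarith
  then have "(1/2, 1/2, 1/4 - e\<^sup>2) \<in> (\<Inter>lam\<in>T. convex hull (agg_set (lam $ 1) (lam $ 2)))"
    using below_arc_in_agg_hull e by auto
  moreover have "(1/2, 1/2, 1/4 - e\<^sup>2) \<notin> convex hull par_arc"
    using e by (intro below_arc_notin_hull) simp
  moreover have "convex hull par_arc \<subseteq> (\<Inter>lam\<in>T. convex hull (agg_set (lam $ 1) (lam $ 2)))"
    by (intro INT_greatest hull_mono par_arc_subset_agg)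
  ultimately show ?thesis
    by (rule strict)
qed

section \<open>Independence and transfer back to the original space\<close>

lemma independent_ex: "independent_constraints 1 2 ex_Q ex_a ex_b (\<lambda>_. 0)"
  unfolding independent_constraints_def
proof
  assume "\<exists>\<mu>. \<forall>x\<in>rspace 1. \<forall>y\<in>rspace 2. bilin_fun 1 2 (ex_Q 1) (ex_a 1) (ex_b 1) 0 x y
    = \<mu> * bilin_fun 1 2 (ex_Q 2) (ex_a 2) (ex_b 2) 0 x y"
  then obtain \<mu> where \<mu>: "\<forall>p\<in>rspace 1 \<times> rspace 2.
      bilin_fun 1 2 (ex_Q 1) (ex_a 1) (ex_b 1) 0 (fst p) (snd p)
      = \<mu> * bilin_fun 1 2 (ex_Q 2) (ex_a 2) (ex_b 2) 0 (fst p) (snd p)"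
    by auto
  \<comment> \<open>Here the first constraint function is 1 and the second is 0, so no factor
    \<open>\<mu>\<close> fits.\<close>
  have "triple_vec (0, 0, 1) \<in> rspace 1 \<times> rspace 2"
    using range_triple_vec by blast
  with \<mu> show False
    using bilin_fun_ex[of 0 0 1] by fastforce
qed

theorem theorem2:
  shows "\<exists>(n1::nat) (n2::nat) (Q :: 2 \<Rightarrow> nat \<Rightarrow> nat \<Rightarrow> real) (a :: 2 \<Rightarrow> rvec) (b :: 2 \<Rightarrow> rvec) (c :: 2 \<Rightarrow> real).
    n1 > 0 \<and> n2 > 0 \<and> n1 + n2 \<ge> 3 \<and>
    (\<forall>k. a k \<in> rspace n1 \<and> b k \<in> rspace n2) \<and>
    bilin_set n1 n2 Q a b c \<noteq> {} \<and>
    independent_constraints n1 n2 Q a b c \<and>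
    convex hull (bilin_set n1 n2 Q a b c) = hull_Inter n1 n2 Q a b c UNIV \<and>
    (\<forall>T :: (real ^ 2) set. finite T \<longrightarrow>
       convex hull (bilin_set n1 n2 Q a b c) \<subset> hull_Inter n1 n2 Q a b c T)"
proof (intro exI conjI allI impI)
  show "(0::nat) < 1" "(0::nat) < 2" "(3::nat) \<le> 1 + 2" by simp_all
  show "ex_a k \<in> rspace 1" "ex_b k \<in> rspace 2" for k
    by (auto simp: ex_a_def ex_b_def rspace_def)
  have "(0, 0, 0) \<in> par_arc" by (simp add: par_arc_def)
  then show "bilin_set 1 2 ex_Q ex_a ex_b (\<lambda>_. 0) \<noteq> {}"
    unfolding bilin_set_ex by blast
  show "independent_constraints 1 2 ex_Q ex_a ex_b (\<lambda>_. 0)"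
    by (rule independent_ex)
  have hull: "convex hull (bilin_set 1 2 ex_Q ex_a ex_b (\<lambda>_. 0)) = triple_vec ` (convex hull par_arc)"
    by (simp only: bilin_set_ex convex_hull_linear_image[OF linear_triple_vec, symmetric])
  show "convex hull (bilin_set 1 2 ex_Q ex_a ex_b (\<lambda>_. 0))
    = hull_Inter 1 2 ex_Q ex_a ex_b (\<lambda>_. 0) UNIV"
    unfolding hull hull_Inter_ex Inter_hull_agg ..
  \<comment> \<open>Strictness carries over because images under an injective map preserve proper
    inclusion.\<close>
  show "convex hull (bilin_set 1 2 ex_Q ex_a ex_b (\<lambda>_. 0))
    \<subset> hull_Inter 1 2 ex_Q ex_a ex_b (\<lambda>_. 0) T" if "finite T" for T
    unfolding hull hull_Inter_ex
    using finite_Inter_hull_agg[OF that] inj_triple_vec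
    by (auto simp: psubset_eq inj_image_eq_iff image_mono)
qed

end
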